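(* Let $\Delta=(V,\mathcal{A})$ be a finite digraph (multiple arcs and multiple loops allowed), with the sets of inverse arcs $a^{-1}$ ($a\in\mathcal{A}$) as defined in the context. Let $\tau_1,\tau_2,\upsilon_1,\upsilon_2:\mathcal{A}\to\mathbb{C}$ be arbitrary maps, put $\tau(a,a')=\tau_1(a)\tau_2(a')$, $\upsilon(a,a')=\upsilon_1(a)\upsilon_2(a')$, and $$\theta(a,a')=\tau(a,a')\,\delta_{\mathfrak{h}(a)\mathfrak{t}(a')}-\upsilon(a,a')\,\delta_{a'\in a^{-1}}\qquad(a,a'\in\mathcal{A}).$$ Let $M_\theta=(\theta(a,a'))_{a,a'\in\mathcal{A}}$, let $Z_\Delta(t;\theta)\in\mathbb{C}[[t]]$ be the graph zeta function of $\Delta$ with weight $\theta$, and let $T$, $A_\Delta(\theta)$, $D_\Delta(\theta)$, $X_\Delta(\theta)$ be the matrices defined in the context. Then $$Z_\Delta(t;\theta)^{-1}=\det(I-tM_\theta)=\det(T)\,\det\bigl(I-tA_\Delta(\theta)+t^2D_\Delta(\theta)-t^3X_\Delta(\theta)\bigr).$$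
   Context: Digraphs. A finite digraph $\Delta=(V,\mathcal{A})$ has a finite vertex set $V$ and a finite multiset $\mathcal{A}$ of ordered pairs of (possibly equal) vertices, called arcs; an arc $a=(u,v)$ has tail $\mathfrak{t}(a)=u$ and head $\mathfrak{h}(a)=v$. (Parallel arcs are distinct elements of $\mathcal{A}$.) Put $\mathcal{A}_{uv}=\{a\in\mathcal{A}:\mathfrak{t}(a)=u,\mathfrak{h}(a)=v\}$ and $\mathcal{A}(u,v)=\mathcal{A}_{uv}\cup\mathcal{A}_{vu}$. Fix a total order $<$ on $V$. Inverse arcs. For a finite graph $G=(V,E)$ (multiple edges and loops allowed), the symmetric digraph $\Delta(G)=(V,\mathcal{A}(G))$ has, for each edge $e=\{u,v\}\in E$, two distinct arcs $a_e=(u,v)$ and $a_e'=(v,u)$ (so a loop yields two loop arcs); one writes $\overline{a_e}=a_e'$ and $\overline{a_e'}=a_e$. For an arc $a$ of $\Delta$, the set $a^{-1}$ of inverse arcs of $a$ is: (i) $a^{-1}=\{\overline{a}\}$ if $\Delta$ is (regarded as) the symmetric digraph $\Delta(G)$ of a graph $G$; (ii) $a^{-1}=\mathcal{A}_{\mathfrak{h}(a)\mathfrak{t}(a)}$ otherwise (in particular $a\in a^{-1}$ if $a$ is a loop). The theorem covers both cases. Let $\mathcal{A}[a]=\{a\}$ in case (i) and $\mathcal{A}[a]=\mathcal{A}_{\mathfrak{t}(a)\mathfrak{h}(a)}$ in case (ii), and let $\mathcal{A}(a)=\mathcal{A}[a]\cup a^{-1}$. Partition of arcs. Let $\Phi_\Delta=\{(u,v)\in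 V\times V: u\le v,\ \mathcal{A}(u,v)\ne\emptyset\}$. For $(u,v)\in\Phi_\Delta$, let $B(u,v)$ be a set of representatives of the blocks $\mathcal{A}(a)$ contained in $\mathcal{A}(u,v)$, chosen inside $\mathcal{A}_{uv}$ if $\mathcal{A}_{uv}\neq\emptyset$ and inside $\mathcal{A}_{vu}$ otherwise; that is, $\mathcal{A}(u,v)=\bigsqcup_{a\in B(u,v)}\mathcal{A}(a)$ (disjoint union). Consequently $\mathcal{A}=\bigsqcup_{(u,v)\in\Phi_\Delta}\bigsqcup_{a\in B(u,v)}\mathcal{A}(a)$. Notation. $\delta_{xy}$ is the Kronecker delta, and for a proposition $P$, $\delta_P=1$ if $P$ is true and $0$ otherwise. Zeta function. A closed path of length $k\ge1$ is a sequence $C=(c_1,\dots,c_k)$ of arcs with $\mathfrak{h}(c_i)=\mathfrak{t}(c_{i+1})$ for $1\le i\le k-1$ and $\mathfrak{h}(c_k)=\mathfrak{t}(c_1)$. Let $X_k$ be the set of closed paths of length $k$, let $\mathrm{circ}_\theta(C)=\theta(c_1,c_2)\theta(c_2,c_3)\cdots\theta(c_k,c_1)$, and $N_k(\mathrm{circ}_\theta)=\sum_{C\in X_k}\mathrm{circ}_\theta(C)$. Then $$Z_\Delta(t;\theta)=\exp\Bigl(\sum_{k\ge1}\frac{N_k(\mathrm{circ}_\theta)}{k}t^k\Bigr)\in\mathbb{C}[[t]].$$ Matrices. Let $J=(j_{aa'})_{a,a'\in\mathcal{A}}$, $K=(k_{av})_{a\in\mathcal{A},v\in V}$, $L=(l_{ua'})_{u\in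 V,a'\in\mathcal{A}}$ with $$j_{aa'}=\upsilon(a,a')\delta_{a'\in a^{-1}},\qquad k_{av}=\tau_1(a)\delta_{\mathfrak{h}(a)v},\qquad l_{ua'}=\tau_2(a')\delta_{u\,\mathfrak{t}(a')}.$$ Let $J(\mathcal{A}(a))$ be the submatrix of $J$ with rows and columns indexed by $\mathcal{A}(a)$, $K(\mathcal{A}(a))$ the submatrix of $K$ with rows indexed by $\mathcal{A}(a)$ (columns by $V$), and $L(\mathcal{A}(a))$ the submatrix of $L$ with columns indexed by $\mathcal{A}(a)$ (rows by $V$). Let $T=I+tJ$. For a set $S$ of arcs let $\upsilon(S)=\sum_{a\in S}\upsilon(a,a)$. Define the $V\times V$ matrices $$A_\Delta(\theta)=\sum_{(u,v)\in\Phi_\Delta}\sum_{a\in B(u,v)}L(\mathcal{A}(a))K(\mathcal{A}(a)),$$ $$D_\Delta(\theta)=\sum_{(u,v)\in\Phi_\Delta}\sum_{a\in B(u,v)}\frac{L(\mathcal{A}(a))J(\mathcal{A}(a))K(\mathcal{A}(a))}{1-\upsilon(\mathcal{A}[a])\,\upsilon(a^{-1})\,t^2},$$ $$X_\Delta(\theta)=\sum_{(u,v)\in\Phi_\Delta}\sum_{a\in B(u,v)}\frac{L(\mathcal{A}(a))J(\mathcal{A}(a))^2K(\mathcal{A}(a))}{1-\upsilon(\mathcal{A}[a])\,\upsilon(a^{-1})\,t^2}.$$ Here $t$ is a formal variable, the fractions are expanded in $\mathbb{C}[[t]]$, and the identities hold in $\mathbb{C}[[t]]$. *)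

theory Defs
  imports
    "Graph_Theory.Digraph"
    "Jordan_Normal_Form.Determinant"
    "HOL-Computational_Algebra.Formal_Power_Series"
    "HOL-Library.Uprod"
    "HOL-Library.Disjoint_Sets"
begin

section \<open>Graphs, symmetric digraphs and inverse arcs\<close>

text \<open>
  Digraphs with parallel arcs and loops are those of the library: arcs are elements of a
  set of their own, with a tail and a head. Undirected graphs may likewise have multiple edges
  and loops; a loop at \<open>u\<close> is an edge with end points \<open>Upair u u\<close>.
\<close>

record ('v, 'e) multigraph =
  gverts :: "'v set"
  gedges :: "'e set"
  gends :: "'e \<Rightarrow> 'v uprod"

definition finite_multigraph :: "('v, 'e) multigraph \<Rightarrow> bool" where
  "finite_multigraph G \<longleftrightarrow> finite (gverts G) \<and> finite (gedges G) \<and>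
     (\<forall>e\<in>gedges G. set_uprod (gends G e) \<subseteq> gverts G)"

text \<open>
  \<open>D\<close> is the symmetric digraph of \<open>G\<close>, where the two arcs belonging to an edge \<open>e\<close> are
  \<open>f e\<close> and \<open>f' e\<close>. The orientation of \<open>f e\<close> is an arbitrary choice.
\<close>

definition symmetric_digraph_of ::
  "('v, 'e) multigraph \<Rightarrow> ('e \<Rightarrow> 'a) \<Rightarrow> ('e \<Rightarrow> 'a) \<Rightarrow> ('v, 'a) pre_digraph \<Rightarrow> bool" where
  "symmetric_digraph_of G f f' D \<longleftrightarrow>
     verts D = gverts G \<and>
     arcs D = f ` gedges G \<union> f' ` gedges G \<and>
     inj_on f (gedges G) \<and> inj_on f' (gedges G) \<and> f ` gedges G \<inter> f' ` gedges G = {} \<and>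
     (\<forall>e\<in>gedges G. gends G e = Upair (tail D (f e)) (head D (f e)) \<and>
        tail D (f' e) = head D (f e) \<and> head D (f' e) = tail D (f e))"

definition opposite_arc :: "('v, 'e) multigraph \<Rightarrow> ('e \<Rightarrow> 'a) \<Rightarrow> ('e \<Rightarrow> 'a) \<Rightarrow> 'a \<Rightarrow> 'a" where
  "opposite_arc G f f' a =
     (if a \<in> f ` gedges G then f' (inv_into (gedges G) f a) else f (inv_into (gedges G) f' a))"

text \<open>
  The inverse arcs depend on whether a digraph is regarded as the symmetric digraph of a
  graph. As this is additional information, not a property of the digraph, it is
  recorded separately: \<open>Sym G f f'\<close> regards the digraph as the symmetric digraph of \<open>G\<close>
  by means of \<open>f\<close> and \<open>f'\<close>, and \<open>Gen\<close> treats it as a general digraph.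
\<close>

datatype ('v, 'e, 'a) digraph_kind =
    Sym "('v, 'e) multigraph" "'e \<Rightarrow> 'a" "'e \<Rightarrow> 'a"
  | Gen

fun admissible_kind :: "('v, 'a) pre_digraph \<Rightarrow> ('v, 'e, 'a) digraph_kind \<Rightarrow> bool" where
  "admissible_kind D (Sym G f f') \<longleftrightarrow> finite_multigraph G \<and> symmetric_digraph_of G f f' D"
| "admissible_kind D Gen \<longleftrightarrow> True"

definition arcs_from_to :: "('v, 'a) pre_digraph \<Rightarrow> 'v \<Rightarrow> 'v \<Rightarrow> 'a set" where
  "arcs_from_to D u v = {a \<in> arcs D. tail D a = u \<and> head D a = v}"

definition arcs_between :: "('v, 'a) pre_digraph \<Rightarrow> 'v \<Rightarrow> 'v \<Rightarrow> 'a set" where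
  "arcs_between D u v = arcs_from_to D u v \<union> arcs_from_to D v u"

text \<open>\<open>inverse_arcs D k a\<close> is $a^{-1}$, \<open>parallel_arcs D k a\<close> is $\mathcal A[a]$ and
  \<open>arc_block D k a\<close> is $\mathcal A(a)$.\<close>

fun inverse_arcs :: "('v, 'a) pre_digraph \<Rightarrow> ('v, 'e, 'a) digraph_kind \<Rightarrow> 'a \<Rightarrow> 'a set" where
  "inverse_arcs D (Sym G f f') a = {opposite_arc G f f' a}"
| "inverse_arcs D Gen a = arcs_from_to D (head D a) (tail D a)"

fun parallel_arcs :: "('v, 'a) pre_digraph \<Rightarrow> ('v, 'e, 'a) digraph_kind \<Rightarrow> 'a \<Rightarrow> 'a set" where
  "parallel_arcs D (Sym G f f') a = {a}"
| "parallel_arcs D Gen a = arcs_from_to D (tail D a) (head D a)"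

definition arc_block :: "('v, 'a) pre_digraph \<Rightarrow> ('v, 'e, 'a) digraph_kind \<Rightarrow> 'a \<Rightarrow> 'a set" where
  "arc_block D k a = parallel_arcs D k a \<union> inverse_arcs D k a"

text \<open>The order on the vertices is given as a reflexive relation \<open>R\<close>.\<close>

definition arc_pairs :: "('v, 'a) pre_digraph \<Rightarrow> 'v rel \<Rightarrow> ('v \<times> 'v) set" where
  "arc_pairs D R =
     {(u, v) \<in> verts D \<times> verts D. (u, v) \<in> R \<and> arcs_between D u v \<noteq> {}}"

definition block_representatives ::
  "('v, 'a) pre_digraph \<Rightarrow> ('v, 'e, 'a) digraph_kind \<Rightarrow> 'v rel \<Rightarrow> ('v \<Rightarrow> 'v \<Rightarrow> 'a set) \<Rightarrow> bool" where
  "block_representatives D k R B \<longleftrightarrow>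
     (\<forall>(u, v) \<in> arc_pairs D R.
        B u v \<subseteq> (if arcs_from_to D u v \<noteq> {} then arcs_from_to D u v else arcs_from_to D v u) \<and>
        arcs_between D u v = (\<Union>a\<in>B u v. arc_block D k a) \<and>
        disjoint_family_on (arc_block D k) (B u v))"

section \<open>The zeta function\<close>

definition closed_paths :: "('v, 'a) pre_digraph \<Rightarrow> nat \<Rightarrow> 'a list set" where
  "closed_paths D k = {c. length c = k \<and> set c \<subseteq> arcs D \<and>
     (\<forall>i<k. head D (c ! i) = tail D (c ! ((i + 1) mod k)))}"

definition circ :: "('a \<Rightarrow> 'a \<Rightarrow> complex) \<Rightarrow> 'a list \<Rightarrow> complex" where
  "circ \<theta> c = (\<Prod>i<length c. \<theta> (c ! i) (c ! ((i + 1) mod length c)))"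

definition circ_sum :: "('v, 'a) pre_digraph \<Rightarrow> ('a \<Rightarrow> 'a \<Rightarrow> complex) \<Rightarrow> nat \<Rightarrow> complex" where
  "circ_sum D \<theta> k = (\<Sum>c\<in>closed_paths D k. circ \<theta> c)"

definition zeta :: "('v, 'a) pre_digraph \<Rightarrow> ('a \<Rightarrow> 'a \<Rightarrow> complex) \<Rightarrow> complex fps" where
  "zeta D \<theta> =
     fps_exp 1 oo Abs_fps (\<lambda>k. if k = 0 then 0 else circ_sum D \<theta> k / of_nat k)"

section \<open>The matrices\<close>

text \<open>
  Matrices whose rows and columns are indexed by finite sets are represented by means of
  distinct lists \<open>xs\<close> and \<open>ys\<close> that enumerate these sets. Below, \<open>as\<close> enumerates the arcs and
  \<open>vs\<close> the vertices. For a set \<open>S\<close> of arcs, \<open>restrict_to as S\<close> is the enumeration of \<open>S\<close> induced by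
  \<open>as\<close>, so that \<open>J_mat D k (restrict_to as S) \<upsilon>\<^sub>1 \<upsilon>\<^sub>2\<close> is the submatrix of \<open>J_mat D k as \<upsilon>\<^sub>1 \<upsilon>\<^sub>2\<close> with rows
  and columns in \<open>S\<close>, and similarly for \<open>K_mat\<close> (rows) and \<open>L_mat\<close> (columns).
\<close>

definition indexed_mat :: "'i list \<Rightarrow> 'j list \<Rightarrow> ('i \<Rightarrow> 'j \<Rightarrow> 'b) \<Rightarrow> 'b mat" where
  "indexed_mat xs ys g = mat (length xs) (length ys) (\<lambda>(i, j). g (xs ! i) (ys ! j))"

definition restrict_to :: "'i list \<Rightarrow> 'i set \<Rightarrow> 'i list" where
  "restrict_to xs S = filter (\<lambda>x. x \<in> S) xs"

definition J_mat ::
  "('v, 'a) pre_digraph \<Rightarrow> ('v, 'e, 'a) digraph_kind \<Rightarrow> 'a list \<Rightarrow>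
   ('a \<Rightarrow> complex) \<Rightarrow> ('a \<Rightarrow> complex) \<Rightarrow> complex mat" where
  "J_mat D k as \<upsilon>\<^sub>1 \<upsilon>\<^sub>2 =
     indexed_mat as as (\<lambda>a a'. \<upsilon>\<^sub>1 a * \<upsilon>\<^sub>2 a' * of_bool (a' \<in> inverse_arcs D k a))"

definition K_mat ::
  "('v, 'a) pre_digraph \<Rightarrow> 'a list \<Rightarrow> 'v list \<Rightarrow> ('a \<Rightarrow> complex) \<Rightarrow> complex mat" where
  "K_mat D as vs \<tau>\<^sub>1 = indexed_mat as vs (\<lambda>a v. \<tau>\<^sub>1 a * of_bool (head D a = v))"

definition L_mat ::
  "('v, 'a) pre_digraph \<Rightarrow> 'a list \<Rightarrow> 'v list \<Rightarrow> ('a \<Rightarrow> complex) \<Rightarrow> complex mat" where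
  "L_mat D as vs \<tau>\<^sub>2 = indexed_mat vs as (\<lambda>u a'. \<tau>\<^sub>2 a' * of_bool (u = tail D a'))"

definition fps_mat :: "complex mat \<Rightarrow> complex fps mat" where
  "fps_mat = map_mat fps_const"

definition T_mat ::
  "('v, 'a) pre_digraph \<Rightarrow> ('v, 'e, 'a) digraph_kind \<Rightarrow> 'a list \<Rightarrow>
   ('a \<Rightarrow> complex) \<Rightarrow> ('a \<Rightarrow> complex) \<Rightarrow> complex fps mat" where
  "T_mat D k as \<upsilon>\<^sub>1 \<upsilon>\<^sub>2 = 1\<^sub>m (length as) + fps_X \<cdot>\<^sub>m fps_mat (J_mat D k as \<upsilon>\<^sub>1 \<upsilon>\<^sub>2)"

definition arc_sum :: "('a \<Rightarrow> complex) \<Rightarrow> ('a \<Rightarrow> complex) \<Rightarrow> 'a set \<Rightarrow> complex" where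
  "arc_sum \<upsilon>\<^sub>1 \<upsilon>\<^sub>2 S = (\<Sum>a\<in>S. \<upsilon>\<^sub>1 a * \<upsilon>\<^sub>2 a)"

definition block_denom ::
  "('v, 'a) pre_digraph \<Rightarrow> ('v, 'e, 'a) digraph_kind \<Rightarrow>
   ('a \<Rightarrow> complex) \<Rightarrow> ('a \<Rightarrow> complex) \<Rightarrow> 'a \<Rightarrow> complex fps" where
  "block_denom D k \<upsilon>\<^sub>1 \<upsilon>\<^sub>2 a =
     1 - fps_const (arc_sum \<upsilon>\<^sub>1 \<upsilon>\<^sub>2 (parallel_arcs D k a) * arc_sum \<upsilon>\<^sub>1 \<upsilon>\<^sub>2 (inverse_arcs D k a))
       * fps_X ^ 2"

text \<open>The sum over all pairs $(u,v)\in\Phi_\Delta$ and all $a\in B(u,v)$ of the $n\times n$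
  matrices \<open>F a\<close>. It is taken entrywise because matrices of type \<open>mat\<close> have no fixed
  dimension and hence no common zero.\<close>

definition block_sum ::
  "('v, 'a) pre_digraph \<Rightarrow> 'v rel \<Rightarrow> ('v \<Rightarrow> 'v \<Rightarrow> 'a set) \<Rightarrow> nat \<Rightarrow>
   ('a \<Rightarrow> 'b::comm_monoid_add mat) \<Rightarrow> 'b mat" where
  "block_sum D R B n F =
     mat n n (\<lambda>ij. \<Sum>(u, v)\<in>arc_pairs D R. \<Sum>a\<in>B u v. F a $$ ij)"

definition A_mat ::
  "('v, 'a) pre_digraph \<Rightarrow> ('v, 'e, 'a) digraph_kind \<Rightarrow> 'v rel \<Rightarrow> ('v \<Rightarrow> 'v \<Rightarrow> 'a set) \<Rightarrow>
   'a list \<Rightarrow> 'v list \<Rightarrow> ('a \<Rightarrow> complex) \<Rightarrow> ('a \<Rightarrow> complex) \<Rightarrow> complex fps mat" where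
  "A_mat D k R B as vs \<tau>\<^sub>1 \<tau>\<^sub>2 =
     block_sum D R B (length vs) (\<lambda>a. let S = restrict_to as (arc_block D k a) in
       fps_mat (L_mat D S vs \<tau>\<^sub>2 * K_mat D S vs \<tau>\<^sub>1))"

definition D_mat ::
  "('v, 'a) pre_digraph \<Rightarrow> ('v, 'e, 'a) digraph_kind \<Rightarrow> 'v rel \<Rightarrow> ('v \<Rightarrow> 'v \<Rightarrow> 'a set) \<Rightarrow>
   'a list \<Rightarrow> 'v list \<Rightarrow> ('a \<Rightarrow> complex) \<Rightarrow> ('a \<Rightarrow> complex) \<Rightarrow>
   ('a \<Rightarrow> complex) \<Rightarrow> ('a \<Rightarrow> complex) \<Rightarrow> complex fps mat" where
  "D_mat D k R B as vs \<tau>\<^sub>1 \<tau>\<^sub>2 \<upsilon>\<^sub>1 \<upsilon>\<^sub>2 =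
     block_sum D R B (length vs) (\<lambda>a. let S = restrict_to as (arc_block D k a) in
       inverse (block_denom D k \<upsilon>\<^sub>1 \<upsilon>\<^sub>2 a) \<cdot>\<^sub>m
       fps_mat (L_mat D S vs \<tau>\<^sub>2 * J_mat D k S \<upsilon>\<^sub>1 \<upsilon>\<^sub>2 * K_mat D S vs \<tau>\<^sub>1))"

definition X_mat ::
  "('v, 'a) pre_digraph \<Rightarrow> ('v, 'e, 'a) digraph_kind \<Rightarrow> 'v rel \<Rightarrow> ('v \<Rightarrow> 'v \<Rightarrow> 'a set) \<Rightarrow>
   'a list \<Rightarrow> 'v list \<Rightarrow> ('a \<Rightarrow> complex) \<Rightarrow> ('a \<Rightarrow> complex) \<Rightarrow>
   ('a \<Rightarrow> complex) \<Rightarrow> ('a \<Rightarrow> complex) \<Rightarrow> complex fps mat" where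
  "X_mat D k R B as vs \<tau>\<^sub>1 \<tau>\<^sub>2 \<upsilon>\<^sub>1 \<upsilon>\<^sub>2 =
     block_sum D R B (length vs) (\<lambda>a. let S = restrict_to as (arc_block D k a) in
       inverse (block_denom D k \<upsilon>\<^sub>1 \<upsilon>\<^sub>2 a) \<cdot>\<^sub>m
       fps_mat (L_mat D S vs \<tau>\<^sub>2 * (J_mat D k S \<upsilon>\<^sub>1 \<upsilon>\<^sub>2 ^\<^sub>m 2) * K_mat D S vs \<tau>\<^sub>1))"

end

theory Submission
  imports
    Defs
    "Jordan_Normal_Form.Char_Poly"
    "Jordan_Normal_Form.Schur_Decomposition"
begin

text \<open>The numbers $N_k$ are the traces of the powers of $M_\theta$, because $\theta$ vanishes on pairs
  of arcs that do not compose. Triangularising $M_\theta$ over the complex numbers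
  reduces the first equation to the identity $\exp(\sum_k \lambda^k t^k/k) = (1-\lambda t)^{-1}$.

  For the second equation, $M_\theta = KL - J$, so $I - tM_\theta = T - tKL$ and
  $\det(I-tM_\theta) = \det T\,\det(I - tLT^{-1}K)$ by Sylvester's identity. In the row of an arc $a$,
  $J^3 = c_a J$ with $c_a = \upsilon(\mathcal A[a])\,\upsilon(a^{-1})$, so that this row of $T^{-1}$ is that of
  $I - (tJ - t^2J^2)/(1-c_at^2)$. As $c_a$ is constant on the blocks $\mathcal A(a)$ and $J$ is block
  diagonal, summation over the blocks gives the stated formula.\<close>

section \<open>Sylvester's determinant identity\<close>

lemma four_block_mult_unitriangular:
  fixes U V :: "'a::comm_ring_1 mat"
  assumes U: "U \<in> carrier_mat n m" and V: "V \<in> carrier_mat m n"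
  shows "four_block_mat (1\<^sub>m n) U V (1\<^sub>m m) * four_block_mat (1\<^sub>m n) (0\<^sub>m n m) (- V) (1\<^sub>m m)
      = four_block_mat (1\<^sub>m n - U * V) U (0\<^sub>m m n) (1\<^sub>m m)"
    and "four_block_mat (1\<^sub>m n) (0\<^sub>m n m) (- V) (1\<^sub>m m) * four_block_mat (1\<^sub>m n) U V (1\<^sub>m m)
      = four_block_mat (1\<^sub>m n) U (0\<^sub>m m n) (1\<^sub>m m - V * U)"
  using assms
  by (subst mult_four_block_mat[of _ n n _ m _ m _ _ n _ m];
      auto intro!: arg_cong4[where f = four_block_mat] eq_matI simp: uminus_scalar_prod)+

text \<open>The block matrices \<open>?N\<close> and \<open>?E\<close> have the same determinant
  product in either order, and each order is block triangular with one nontrivial diagonal block. No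
  inverse is involved, so the identity applies to matrices over power series.\<close>

lemma det_one_minus_mult_commute:
  fixes U V :: "'a::idom mat"
  assumes U: "U \<in> carrier_mat n m" and V: "V \<in> carrier_mat m n"
  shows "det (1\<^sub>m n - U * V) = det (1\<^sub>m m - V * U)"
proof -
  let ?N = "four_block_mat (1\<^sub>m n) U V (1\<^sub>m m)"
  let ?E = "four_block_mat (1\<^sub>m n) (0\<^sub>m n m) (- V) (1\<^sub>m m)"
  have carrier: "?N \<in> carrier_mat (n + m) (n + m)" "?E \<in> carrier_mat (n + m) (n + m)"
    by simp_all
  have "det (1\<^sub>m n - U * V) = det (?N * ?E)"
    unfolding four_block_mult_unitriangular(1)[OF assms] using assms
    by (subst det_four_block_mat_lower_left_zero[of _ n _ m]) auto
  also have "\<dots> = det (?E * ?N)"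
    using carrier by (simp add: det_mult[of _ "n + m"])
  also have "\<dots> = det (1\<^sub>m m - V * U)"
    unfolding four_block_mult_unitriangular(2)[OF assms] using assms
    by (subst det_four_block_mat_lower_left_zero[of _ n _ m]) auto
  finally show ?thesis .
qed

section \<open>Traces and upper triangular matrices\<close>

lemma trace_mult_commute:
  fixes U V :: "'a::comm_semiring_0 mat"
  assumes "U \<in> carrier_mat n m" and "V \<in> carrier_mat m n"
  shows "(\<Sum>i<n. (U * V) $$ (i, i)) = (\<Sum>i<m. (V * U) $$ (i, i))"
proof -
  have "(\<Sum>i<n. (U * V) $$ (i, i)) = (\<Sum>i<n. \<Sum>j<m. U $$ (i, j) * V $$ (j, i))"
    using assms by (auto simp: scalar_prod_def atLeast0LessThan intro!: sum.cong)
  also have "\<dots> = (\<Sum>j<m. \<Sum>i<n. V $$ (j, i) * U $$ (i, j))"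
    by (subst sum.swap) (simp add: mult.commute)
  also have "\<dots> = (\<Sum>i<m. (V * U) $$ (i, i))"
    using assms by (auto simp: scalar_prod_def atLeast0LessThan intro!: sum.cong)
  finally show ?thesis .
qed

text \<open>A term \<open>A $$ (i, k) * B $$ (k, j)\<close> survives only for i \<le> k \<le> j.
  This range is empty below the diagonal and is the single index i on it.\<close>

lemma upper_triangular_mult:
  fixes A B :: "'a::semiring_0 mat"
  assumes A: "A \<in> carrier_mat n n" "upper_triangular A"
    and B: "B \<in> carrier_mat n n" "upper_triangular B"
  shows "upper_triangular (A * B)"
    and "i < n \<Longrightarrow> (A * B) $$ (i, i) = A $$ (i, i) * B $$ (i, i)"
proof -
  have entry: "(A * B) $$ (i, j) = (\<Sum>k<n. A $$ (i, k) * B $$ (k, j))" if "i < n" "j < n" for i j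
    using that A B by (simp add: scalar_prod_def atLeast0LessThan)
  have zero: "A $$ (i, k) * B $$ (k, j) = 0" if "k < n" "i < n" "k < i \<or> j < k" for i j k
    using that A B by (auto simp: upper_triangular_def)
  show "upper_triangular (A * B)"
  proof
    fix i j assume "j < i" "i < dim_row (A * B)"
    then have ij: "i < n" "j < n" "j < i" using A by auto
    show "(A * B) $$ (i, j) = 0"
      unfolding entry[OF ij(1,2)] using ij by (intro sum.neutral ballI zero) auto
  qed
  show "(A * B) $$ (i, i) = A $$ (i, i) * B $$ (i, i)" if "i < n"
  proof -
    have "(A * B) $$ (i, i) = (\<Sum>k\<in>{i}. A $$ (i, k) * B $$ (k, i))"
      unfolding entry[OF that that] using that
      by (intro sum.mono_neutral_right ballI zero) auto
    then show ?thesis by simp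
  qed
qed

lemma upper_triangular_pow:
  fixes A :: "'a::semiring_1 mat"
  assumes A: "A \<in> carrier_mat n n" "upper_triangular A"
  shows "upper_triangular (A ^\<^sub>m k) \<and> (\<forall>i<n. (A ^\<^sub>m k) $$ (i, i) = A $$ (i, i) ^ k)"
proof (induction k)
  case (Suc k)
  then show ?case
    using upper_triangular_mult[OF pow_carrier_mat[OF A(1)] _ A]
    by (simp add: power_commutes)
qed (use A in auto)

section \<open>Exponentials of power sums and of traces\<close>

text \<open>The exponential and the product have opposite logarithmic derivatives, so multiplying
  them gives a constant series, whose value is read off at 0.\<close>

lemma exp_power_sums:
  fixes c :: "'i \<Rightarrow> 'a::field_char_0"
  assumes "finite I"
  shows "inverse (fps_exp 1 oo Abs_fps (\<lambda>k. if k = 0 then 0 else (\<Sum>i\<in>I. c i ^ k) / of_nat k))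
    = (\<Prod>i\<in>I. 1 - fps_const (c i) * fps_X)"
proof -
  define g where "g = Abs_fps (\<lambda>k. if k = 0 then 0 else (\<Sum>i\<in>I. c i ^ k) / of_nat k)"
  define Z where "Z = fps_exp 1 oo g"
  define P where "P = (\<Prod>i\<in>I. 1 - fps_const (c i) * fps_X)"
  \<comment> \<open>\<open>G i\<close> is the series c_i / (1 - c_i t), the derivative of -log (1 -
    c_i t).\<close>
  define G where "G i = Abs_fps (\<lambda>k. c i ^ Suc k)" for i
  have g0: "fps_nth g 0 = 0" by (simp add: g_def)
  have dg: "fps_deriv g = (\<Sum>i\<in>I. G i)"
  proof (rule fps_ext)
    fix n
    \<comment> \<open>Differentiation brings down the factor n + 1, which cancels the denominator in
      characteristic 0.\<close>
    have "of_nat (Suc n) \<noteq> (0 :: 'a)" by (rule of_nat_neq_0)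
    then show "fps_nth (fps_deriv g) n = fps_nth (\<Sum>i\<in>I. G i) n"
      by (simp add: g_def G_def fps_sum_nth field_simps del: of_nat_Suc)
  qed
  have dZ: "fps_deriv Z = Z * fps_deriv g"
    unfolding Z_def by (subst fps_compose_deriv[OF g0]) simp
  have G: "(1 - fps_const (c i) * fps_X) * G i = fps_const (c i)" for i
  proof (rule fps_ext)
    fix n show "fps_nth ((1 - fps_const (c i) * fps_X) * G i) n = fps_nth (fps_const (c i)) n"
      by (cases n) (simp_all add: G_def left_diff_distrib mult.assoc)
  qed
  have dP: "fps_deriv P = - P * (\<Sum>i\<in>I. G i)"
    unfolding P_def using assms
  proof (induction I rule: finite_induct)
    case (insert j I)
    let ?Q = "\<Prod>i\<in>I. 1 - fps_const (c i) * fps_X"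
    \<comment> \<open>The derivative -c_j of the new factor is written as minus that factor times
      \<open>G j\<close>, so that the whole product can be factored out again.\<close>
    have "fps_deriv (\<Prod>i\<in>insert j I. 1 - fps_const (c i) * fps_X)
        = - ((1 - fps_const (c j) * fps_X) * G j) * ?Q
          - (1 - fps_const (c j) * fps_X) * (?Q * (\<Sum>i\<in>I. G i))"
      using insert unfolding G by (simp add: algebra_simps del: fps_const_neg)
    also have "\<dots> = - (\<Prod>i\<in>insert j I. 1 - fps_const (c i) * fps_X) * (\<Sum>i\<in>insert j I. G i)"
      using insert by (simp add: algebra_simps)
    finally show ?case .
  qed simp
  have "fps_deriv (Z * P) = 0"
    by (simp add: dZ dP dg algebra_simps)
  then have "Z * P = fps_const (fps_nth (Z * P) 0)"
    by (rule fps_deriv_eq_0_iff[THEN iffD1])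
  moreover have "fps_nth P 0 = 1"
    unfolding P_def using assms by (induction I rule: finite_induct) auto
  moreover have "fps_nth Z 0 = 1" by (simp add: Z_def)
  ultimately have "Z * P = 1" by simp
  then have "inverse Z = P" by (rule fps_inverse_unique)
  then show ?thesis by (simp add: Z_def P_def g_def)
qed

interpretation fps_const_hom: comm_ring_hom "fps_const :: 'a::comm_ring_1 \<Rightarrow> 'a fps"
  by unfold_locales auto

lemma fps_const_sum:
  fixes f :: "'a \<Rightarrow> 'b::comm_ring_1"
  shows "fps_const (\<Sum>x\<in>A. f x) = (\<Sum>x\<in>A. fps_const (f x))"
  by (rule fps_const_hom.hom_sum)

lemma fps_mat_carrier [simp]: "fps_mat A \<in> carrier_mat n m \<longleftrightarrow> A \<in> carrier_mat n m"
  by (auto simp: fps_mat_def)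

lemma fps_mat_mult:
  assumes "A \<in> carrier_mat n m" and "B \<in> carrier_mat m p"
  shows "fps_mat (A * B) = fps_mat A * fps_mat B"
  unfolding fps_mat_def by (rule fps_const_hom.mat_hom_mult[OF assms])

text \<open>Both sides are invariant under similarity. A Schur decomposition therefore reduces the
  claim to a triangular matrix, where the traces are power sums of the diagonal entries and the
  determinant is the product over them.\<close>

lemma exp_traces_eq_det:
  fixes M :: "complex mat"
  assumes M: "M \<in> carrier_mat n n"
  shows "inverse (fps_exp 1 oo
      Abs_fps (\<lambda>k. if k = 0 then 0 else (\<Sum>i<n. (M ^\<^sub>m k) $$ (i, i)) / of_nat k))
    = det (1\<^sub>m n - fps_X \<cdot>\<^sub>m fps_mat M)"
proof -
  obtain es where es: "char_poly M = (\<Prod>a\<leftarrow>es. [:- a, 1:])"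
    using char_poly_factorized[OF M] by blast
  obtain C P Q where "schur_decomposition M es = (C, P, Q)"
    by (cases "schur_decomposition M es")
  from schur_decomposition[OF M es this]
  have sim: "similar_mat_wit M C P Q" and ut: "upper_triangular C" by auto
  note simD = similar_mat_witD2[OF M sim]
  have C: "C \<in> carrier_mat n n" by fact
  have tr: "(\<Sum>i<n. (M ^\<^sub>m k) $$ (i, i)) = (\<Sum>i<n. C $$ (i, i) ^ k)" for k
  proof -
    have Ck: "C ^\<^sub>m k \<in> carrier_mat n n" using C by simp
    \<comment> \<open>Bracketed in this way, cyclicity of the trace moves \<open>P\<close> to the
      right end, where it cancels against \<open>Q\<close>.\<close>
    have "M ^\<^sub>m k = P * (C ^\<^sub>m k * Q)"
      using similar_mat_wit_pow_id[OF sim] simD Ck by (simp add: assoc_mult_mat[of _ n n _ n _ n])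
    moreover have "C ^\<^sub>m k * Q \<in> carrier_mat n n" using Ck simD(7) by simp
    ultimately have "(\<Sum>i<n. (M ^\<^sub>m k) $$ (i, i)) = (\<Sum>i<n. (C ^\<^sub>m k * Q * P) $$ (i, i))"
      using trace_mult_commute[OF simD(6)] by metis
    also have "C ^\<^sub>m k * Q * P = C ^\<^sub>m k"
      using simD Ck by (simp add: assoc_mult_mat[of _ n n _ n _ n])
    finally show ?thesis
      using upper_triangular_pow[OF C ut, of k] by simp
  qed
  \<comment> \<open>Sylvester's identity carries \<open>P\<close> to the other side of the product,
    which plays the role of conjugation over power series.\<close>
  have "det (1\<^sub>m n - fps_X \<cdot>\<^sub>m fps_mat M) = det (1\<^sub>m n - fps_mat P * (fps_X \<cdot>\<^sub>m fps_mat (C * Q)))"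
    using simD
    by (simp add: fps_mat_mult[of _ n n _ n] assoc_mult_mat[of _ n n _ n _ n]
        mult_smult_distrib[of _ n n _ n])
  also have "\<dots> = det (1\<^sub>m n - fps_X \<cdot>\<^sub>m fps_mat (C * Q) * fps_mat P)"
    using simD by (intro det_one_minus_mult_commute) auto
  also have "fps_X \<cdot>\<^sub>m fps_mat (C * Q) * fps_mat P = fps_X \<cdot>\<^sub>m (fps_mat (C * Q) * fps_mat P)"
    using simD by (intro mult_smult_assoc_mat) auto
  also have "fps_mat (C * Q) * fps_mat P = fps_mat (C * Q * P)"
    using simD by (intro fps_mat_mult[symmetric]) auto
  also have "C * Q * P = C * (Q * P)"
    using simD by (intro assoc_mult_mat) auto
  also have "C * (Q * P) = C" using simD by simp
  also have "det (1\<^sub>m n - fps_X \<cdot>\<^sub>m fps_mat C) = (\<Prod>i<n. 1 - fps_const (C $$ (i, i)) * fps_X)"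
  proof -
    have "upper_triangular (1\<^sub>m n - fps_X \<cdot>\<^sub>m fps_mat C)"
      using ut C by (auto simp: fps_mat_def upper_triangular_def)
    then have "det (1\<^sub>m n - fps_X \<cdot>\<^sub>m fps_mat C)
        = prod_list (diag_mat (1\<^sub>m n - fps_X \<cdot>\<^sub>m fps_mat C))"
      using C by (intro det_upper_triangular[of _ n]) auto
    then show ?thesis
      using C by (simp add: prod_list_diag_prod fps_mat_def atLeast0LessThan mult.commute)
  qed
  finally show ?thesis
    unfolding tr using exp_power_sums[of "{..<n}" "\<lambda>i. C $$ (i, i)"] by simp
qed

section \<open>Matrices indexed by distinct lists\<close>

lemma sum_nth_distinct: "distinct xs \<Longrightarrow> (\<Sum>i<length xs. f (xs ! i)) = (\<Sum>x\<in>set xs. f x)"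
  by (rule sum.reindex_bij_betw[OF bij_betw_nth]) auto

lemma indexed_mat_carrier [simp]: "indexed_mat xs ys f \<in> carrier_mat (length xs) (length ys)"
  by (simp add: indexed_mat_def)

lemma indexed_mat_dim [simp]:
  "dim_row (indexed_mat xs ys f) = length xs" "dim_col (indexed_mat xs ys f) = length ys"
  by (simp_all add: indexed_mat_def)

lemma indexed_mat_index [simp]:
  "i < length xs \<Longrightarrow> j < length ys \<Longrightarrow> indexed_mat xs ys f $$ (i, j) = f (xs ! i) (ys ! j)"
  by (simp add: indexed_mat_def)

lemma indexed_mat_cong:
  assumes "\<And>x y. x \<in> set xs \<Longrightarrow> y \<in> set ys \<Longrightarrow> f x y = g x y"
  shows "indexed_mat xs ys f = indexed_mat xs ys g"
  by (rule eq_matI) (auto simp: assms)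

text \<open>Distinctness of the middle list turns the sum over positions into a sum over the
  enumerated set. Matrix identities thereby become identities between sums over arcs or
  vertices.\<close>

lemma indexed_mat_mult:
  assumes "distinct ys"
  shows "indexed_mat xs ys f * indexed_mat ys zs g
    = indexed_mat xs zs (\<lambda>x z. \<Sum>y\<in>set ys. f x y * g y z)"
  using assms
  by (intro eq_matI)
    (auto simp: scalar_prod_def atLeast0LessThan sum_nth_distinct[symmetric])

lemma indexed_mat_one: "distinct xs \<Longrightarrow> 1\<^sub>m (length xs) = indexed_mat xs xs (\<lambda>x y. of_bool (x = y))"
  by (intro eq_matI) (auto simp: nth_eq_iff_index_eq)

lemma indexed_mat_arith:
  "indexed_mat xs ys f + indexed_mat xs ys g = indexed_mat xs ys (\<lambda>x y. f x y + g x y)"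
  "indexed_mat xs ys h - indexed_mat xs ys h' = indexed_mat xs ys (\<lambda>x y. h x y - h' x y)"
  "c \<cdot>\<^sub>m indexed_mat xs ys p = indexed_mat xs ys (\<lambda>x y. c * p x y)"
  "fps_mat (indexed_mat xs ys q) = indexed_mat xs ys (\<lambda>x y. fps_const (q x y))"
  by (auto intro!: eq_matI simp: fps_mat_def)

section \<open>Closed paths and traces of matrix powers\<close>

text \<open>Shifting the list by one place pairs each entry of the walk with its successor. The end
  points are kept apart from the inner list because they become the row and column index of a matrix
  power.\<close>

definition walk_weight :: "('a \<Rightarrow> 'a \<Rightarrow> 'b::comm_semiring_1) \<Rightarrow> 'a \<Rightarrow> 'a list \<Rightarrow> 'a \<Rightarrow> 'b" where
  "walk_weight \<theta> x cs y = (\<Prod>i<Suc (length cs). \<theta> ((x # cs) ! i) ((cs @ [y]) ! i))"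

lemma walk_weight_simps [simp]:
  "walk_weight \<theta> x [] y = \<theta> x y"
  "walk_weight \<theta> x (c # cs) y = \<theta> x c * walk_weight \<theta> c cs y"
  by (simp_all add: walk_weight_def prod.lessThan_Suc_shift del: prod.lessThan_Suc)

text \<open>Expanding the product peels off the first inner entry of the walk. A power with exponent
  n + 1 has n inner entries.\<close>

lemma indexed_mat_pow:
  fixes \<theta> :: "'a \<Rightarrow> 'a \<Rightarrow> 'b::comm_semiring_1"
  assumes "distinct xs"
  shows "indexed_mat xs xs \<theta> ^\<^sub>m Suc n
    = indexed_mat xs xs (\<lambda>x y. \<Sum>cs | set cs \<subseteq> set xs \<and> length cs = n. walk_weight \<theta> x cs y)"
proof (induction n)
  case 0
  have "{cs :: 'a list. set cs \<subseteq> set xs \<and> cs = []} = {[]}" by auto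
  then show ?case by simp
next
  case (Suc n)
  let ?A = "indexed_mat xs xs \<theta>"
  let ?L = "\<lambda>n. {cs. set cs \<subseteq> set xs \<and> length cs = n}"
  \<comment> \<open>Matrix powers are defined by multiplication on the right, while walks are
    extended on the left.\<close>
  have comm: "?A ^\<^sub>m k * ?A = ?A * ?A ^\<^sub>m k" for k
  proof (induction k)
    case (Suc k)
    have "?A ^\<^sub>m k \<in> carrier_mat (length xs) (length xs)" by simp
    then have "?A * ?A ^\<^sub>m k * ?A = ?A * (?A ^\<^sub>m k * ?A)"
      by (intro assoc_mult_mat) auto
    then show ?case using Suc by simp
  qed simp
  have "?A ^\<^sub>m Suc (Suc n) = ?A * ?A ^\<^sub>m Suc n"
    using comm[of "Suc n"] by (simp only: pow_mat.simps(2))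
  also have "\<dots> = indexed_mat xs xs (\<lambda>x y. \<Sum>c\<in>set xs. \<theta> x c * (\<Sum>cs\<in>?L n. walk_weight \<theta> c cs y))"
    unfolding Suc by (rule indexed_mat_mult[OF assms])
  also have "\<dots> = indexed_mat xs xs (\<lambda>x y. \<Sum>cs\<in>?L (Suc n). walk_weight \<theta> x cs y)"
  proof (intro indexed_mat_cong)
    fix x y
    have inj: "inj_on (\<lambda>(cs, c). c # cs) (?L n \<times> set xs)"
      by (auto simp: inj_on_def)
    have "(\<Sum>cs\<in>?L (Suc n). walk_weight \<theta> x cs y)
        = (\<Sum>cs\<in>?L n. \<Sum>c\<in>set xs. \<theta> x c * walk_weight \<theta> c cs y)"
      unfolding lists_length_Suc_eq sum.reindex[OF inj]
      by (simp add: sum.cartesian_product case_prod_unfold)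
    also have "\<dots> = (\<Sum>c\<in>set xs. \<theta> x c * (\<Sum>cs\<in>?L n. walk_weight \<theta> c cs y))"
      by (subst sum.swap) (simp add: sum_distrib_left)
    finally show "(\<Sum>c\<in>set xs. \<theta> x c * (\<Sum>cs\<in>?L n. walk_weight \<theta> c cs y))
        = (\<Sum>cs\<in>?L (Suc n). walk_weight \<theta> x cs y)" by simp
  qed
  finally show ?case .
qed

text \<open>The cyclic index wraps around only at the last position, where the appended
  \<open>x\<close> supplies the same value.\<close>

lemma circ_Cons: "circ \<theta> (x # cs) = walk_weight \<theta> x cs x"
  unfolding circ_def walk_weight_def
proof (rule prod.cong)
  fix i assume "i \<in> {..<Suc (length cs)}"
  then show "\<theta> ((x # cs) ! i) ((x # cs) ! ((i + 1) mod length (x # cs)))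
      = \<theta> ((x # cs) ! i) ((cs @ [x]) ! i)"
    by (cases "i = length cs") (auto simp: nth_append)
qed simp

text \<open>A list of arcs that is not a closed path contains a pair that does not compose, and the
  factor \<theta> of that pair is 0. The sum may thus run over all lists of the given length; the
  first arc is then the diagonal index and the others are the inner entries of a walk.\<close>

lemma circ_sum_eq_trace:
  assumes "distinct as" and "set as = arcs D"
    and \<theta>: "\<And>a a'. a \<in> arcs D \<Longrightarrow> \<theta> a a' \<noteq> 0 \<Longrightarrow> head D a = tail D a'"
    and "k > 0"
  shows "circ_sum D \<theta> k = (\<Sum>i<length as. (indexed_mat as as \<theta> ^\<^sub>m k) $$ (i, i))"
proof -
  obtain n where k: "k = Suc n" using \<open>k > 0\<close> by (cases k) auto
  let ?L = "\<lambda>n. {cs. set cs \<subseteq> set as \<and> length cs = n}"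
  have inj: "inj_on (\<lambda>(cs, c). c # cs) (?L n \<times> set as)"
    by (auto simp: inj_on_def)
  have "circ_sum D \<theta> k = (\<Sum>c\<in>?L k. circ \<theta> c)"
    unfolding circ_sum_def
  proof (rule sum.mono_neutral_left)
    show "finite (?L k)" by (simp add: finite_lists_length_eq)
    show "closed_paths D k \<subseteq> ?L k" by (auto simp: closed_paths_def assms)
    show "\<forall>c\<in>?L k - closed_paths D k. circ \<theta> c = 0"
    proof
      fix c assume c: "c \<in> ?L k - closed_paths D k"
      then obtain i where i: "i < k" "head D (c ! i) \<noteq> tail D (c ! ((i + 1) mod k))"
        by (auto simp: closed_paths_def assms)
      moreover have "c ! i \<in> arcs D" using c i by (auto simp: assms)
      ultimately have "\<theta> (c ! i) (c ! ((i + 1) mod k)) = 0" using \<theta> by blast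
      then show "circ \<theta> c = 0" using c i by (auto simp: circ_def intro!: prod_zero)
    qed
  qed
  also have "\<dots> = (\<Sum>cs\<in>?L n. \<Sum>c\<in>set as. circ \<theta> (c # cs))"
    unfolding k lists_length_Suc_eq sum.reindex[OF inj]
    by (simp add: sum.cartesian_product case_prod_unfold)
  also have "\<dots> = (\<Sum>c\<in>set as. \<Sum>cs\<in>?L n. walk_weight \<theta> c cs c)"
    by (subst sum.swap) (simp add: circ_Cons)
  also have "\<dots> = (\<Sum>i<length as. (indexed_mat as as \<theta> ^\<^sub>m k) $$ (i, i))"
    unfolding k indexed_mat_pow[OF assms(1)] sum_nth_distinct[OF assms(1), symmetric] by simp
  finally show ?thesis .
qed

lemma zeta_eq_det:
  assumes "distinct as" and "set as = arcs D"
    and "\<And>a a'. a \<in> arcs D \<Longrightarrow> \<theta> a a' \<noteq> 0 \<Longrightarrow> head D a = tail D a'"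
  shows "inverse (zeta D \<theta>) = det (1\<^sub>m (length as) - fps_X \<cdot>\<^sub>m fps_mat (indexed_mat as as \<theta>))"
proof -
  \<comment> \<open>The trace formula holds for positive k only; at k = 0 both sequences are set to
    0.\<close>
  have "(\<lambda>k. if k = 0 then 0 else circ_sum D \<theta> k / of_nat k)
      = (\<lambda>k. if k = 0 then 0
          else (\<Sum>i<length as. (indexed_mat as as \<theta> ^\<^sub>m k) $$ (i, i)) / of_nat k)"
    using circ_sum_eq_trace[OF assms] by auto
  then show ?thesis
    unfolding zeta_def by (simp add: exp_traces_eq_det[OF indexed_mat_carrier])
qed

section \<open>Inverse arcs and the decomposition into blocks\<close>

lemma symmetric_digraph_opposite_arc:
  assumes "symmetric_digraph_of G f f' D" and "a \<in> arcs D"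
  shows "opposite_arc G f f' a \<in> arcs D"
    and "tail D (opposite_arc G f f' a) = head D a"
    and "head D (opposite_arc G f f' a) = tail D a"
    and "opposite_arc G f f' (opposite_arc G f f' a) = a"
proof -
  have sym: "arcs D = f ` gedges G \<union> f' ` gedges G" "inj_on f (gedges G)" "inj_on f' (gedges G)"
      "f ` gedges G \<inter> f' ` gedges G = {}"
      "\<And>e. e \<in> gedges G \<Longrightarrow> tail D (f' e) = head D (f e) \<and> head D (f' e) = tail D (f e)"
    using assms(1) by (auto simp: symmetric_digraph_of_def)
  \<comment> \<open>Disjointness of the two images makes the case distinction in
    \<open>opposite_arc\<close> choose correctly, and injectivity recovers the edge.\<close>
  have opp: "opposite_arc G f f' (f e) = f' e" "opposite_arc G f f' (f' e) = f e"
    if "e \<in> gedges G" for e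
    using that sym by (auto simp: opposite_arc_def)
  obtain e where "e \<in> gedges G" "a = f e \<or> a = f' e"
    using assms(2) sym(1) by auto
  then show "opposite_arc G f f' a \<in> arcs D"
    and "tail D (opposite_arc G f f' a) = head D a"
    and "head D (opposite_arc G f f' a) = tail D a"
    and "opposite_arc G f f' (opposite_arc G f f' a) = a"
    using sym(1,5) opp by auto
qed

context
  fixes D :: "('v, 'a) pre_digraph" and k :: "('v, 'e, 'a) digraph_kind"
  assumes admissible: "admissible_kind D k"
begin

lemma inverse_arcs_subset:
  "a \<in> arcs D \<Longrightarrow> inverse_arcs D k a \<subseteq> arcs_from_to D (head D a) (tail D a)"
  using admissible
  by (cases k) (auto simp: arcs_from_to_def symmetric_digraph_opposite_arc)

lemma parallel_arcs_subset:
  "a \<in> arcs D \<Longrightarrow> parallel_arcs D k a \<subseteq> arcs_from_to D (tail D a) (head D a)"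
  by (cases k) (auto simp: arcs_from_to_def)

text \<open>In the symmetric case the classes are singletons and reversal is an involution. In the
  general case a class depends only on its end points, which are interchanged.\<close>

lemma parallel_arcs_inverse:
  "a \<in> arcs D \<Longrightarrow> b \<in> inverse_arcs D k a \<Longrightarrow> parallel_arcs D k b = inverse_arcs D k a"
  "a \<in> arcs D \<Longrightarrow> b \<in> inverse_arcs D k a \<Longrightarrow> inverse_arcs D k b = parallel_arcs D k a"
  using admissible
  by (cases k; auto simp: arcs_from_to_def symmetric_digraph_opposite_arc)+

lemma inverse_arcs_parallel:
  "b \<in> parallel_arcs D k a \<Longrightarrow> parallel_arcs D k b = parallel_arcs D k a"
  "b \<in> parallel_arcs D k a \<Longrightarrow> inverse_arcs D k b = inverse_arcs D k a"
  by (cases k; auto simp: arcs_from_to_def)+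

lemma arc_block_subset: "a \<in> arcs D \<Longrightarrow> arc_block D k a \<subseteq> arcs D"
  using inverse_arcs_subset parallel_arcs_subset
  by (fastforce simp: arc_block_def arcs_from_to_def)

text \<open>This is block diagonality of \<open>J\<close>: no nonzero entry leads from a block to an
  arc outside it.\<close>

lemma inverse_arcs_subset_block:
  assumes "r \<in> arcs D" and "a \<in> arc_block D k r"
  shows "inverse_arcs D k a \<subseteq> arc_block D k r"
  using assms(2) parallel_arcs_inverse(2)[OF assms(1), of a] inverse_arcs_parallel(2)[of a r]
  by (auto simp: arc_block_def)

text \<open>Within a block, passing to a parallel arc keeps both factors of the constant, and
  passing to an inverse arc exchanges them.\<close>

lemma block_denom_block:
  assumes "r \<in> arcs D" and "a \<in> arc_block D k r"
  shows "block_denom D k \<upsilon>\<^sub>1 \<upsilon>\<^sub>2 a = block_denom D k \<upsilon>\<^sub>1 \<upsilon>\<^sub>2 r"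
  using assms(2) parallel_arcs_inverse[OF assms(1), of a] inverse_arcs_parallel[of a r]
  by (auto simp: arc_block_def block_denom_def mult.commute)

lemma sum_inverse_arcs:
  fixes g :: "'a \<Rightarrow> 'b::comm_semiring_1"
  assumes "finite A" and "inverse_arcs D k a \<subseteq> A"
  shows "(\<Sum>b\<in>A. (\<upsilon>\<^sub>1 a * \<upsilon>\<^sub>2 b * of_bool (b \<in> inverse_arcs D k a)) * g b)
    = \<upsilon>\<^sub>1 a * (\<Sum>b\<in>inverse_arcs D k a. \<upsilon>\<^sub>2 b * g b)"
proof -
  have "(\<Sum>b\<in>A. (\<upsilon>\<^sub>1 a * \<upsilon>\<^sub>2 b * of_bool (b \<in> inverse_arcs D k a)) * g b)
      = (\<Sum>b\<in>inverse_arcs D k a. \<upsilon>\<^sub>1 a * (\<upsilon>\<^sub>2 b * g b))"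
    using assms by (intro sum.mono_neutral_cong_right) (auto simp: mult.assoc)
  then show ?thesis by (simp add: sum_distrib_left)
qed

text \<open>This is the reason for the denominators: \<open>J\<close> is of rank one from a class of parallel arcs to
  its inverse class, and the product of two inverse steps leads back to the original class.\<close>

lemma J_cubed:
  fixes \<upsilon>\<^sub>1 \<upsilon>\<^sub>2 :: "'a \<Rightarrow> complex"
  defines "J \<equiv> \<lambda>a a'. \<upsilon>\<^sub>1 a * \<upsilon>\<^sub>2 a' * of_bool (a' \<in> inverse_arcs D k a)"
  assumes "finite (arcs D)" and a: "a \<in> arcs D"
  shows "(\<Sum>b\<in>arcs D. J a b * (\<Sum>e\<in>arcs D. J b e * J e a'))
    = arc_sum \<upsilon>\<^sub>1 \<upsilon>\<^sub>2 (parallel_arcs D k a) * arc_sum \<upsilon>\<^sub>1 \<upsilon>\<^sub>2 (inverse_arcs D k a) * J a a'"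
proof -
  have sub: "inverse_arcs D k b \<subseteq> arcs D" if "b \<in> arcs D" for b
    using inverse_arcs_subset[OF that] by (auto simp: arcs_from_to_def)
  have J_sum: "(\<Sum>e\<in>arcs D. J b e * g e) = \<upsilon>\<^sub>1 b * (\<Sum>e\<in>inverse_arcs D k b. \<upsilon>\<^sub>2 e * g e)"
    if "b \<in> arcs D" for b g
    unfolding J_def by (rule sum_inverse_arcs[OF assms(2) sub[OF that]])
  \<comment> \<open>The second inverse step returns to the class of \<open>a\<close>, where the
    indicator in \<open>J e a'\<close> is the same for every \<open>e\<close>; only the sum of the
    diagonal weights remains.\<close>
  have inner: "(\<Sum>e\<in>arcs D. J b e * J e a')
      = \<upsilon>\<^sub>1 b * (arc_sum \<upsilon>\<^sub>1 \<upsilon>\<^sub>2 (parallel_arcs D k a) * (\<upsilon>\<^sub>2 a' * of_bool (a' \<in> inverse_arcs D k a)))"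
    if "b \<in> inverse_arcs D k a" for b
  proof -
    have "b \<in> arcs D" using that sub[OF a] by blast
    then have "(\<Sum>e\<in>arcs D. J b e * J e a') = \<upsilon>\<^sub>1 b * (\<Sum>e\<in>parallel_arcs D k a. \<upsilon>\<^sub>2 e * J e a')"
      using J_sum parallel_arcs_inverse[OF a that] by simp
    also have "(\<Sum>e\<in>parallel_arcs D k a. \<upsilon>\<^sub>2 e * J e a')
        = (\<Sum>e\<in>parallel_arcs D k a. (\<upsilon>\<^sub>1 e * \<upsilon>\<^sub>2 e) * (\<upsilon>\<^sub>2 a' * of_bool (a' \<in> inverse_arcs D k a)))"
      by (intro sum.cong refl) (simp add: J_def inverse_arcs_parallel)
    finally show ?thesis by (simp add: arc_sum_def sum_distrib_right)
  qed
  have "(\<Sum>b\<in>arcs D. J a b * (\<Sum>e\<in>arcs D. J b e * J e a'))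
      = \<upsilon>\<^sub>1 a * (\<Sum>b\<in>inverse_arcs D k a. (\<upsilon>\<^sub>1 b * \<upsilon>\<^sub>2 b) *
          (arc_sum \<upsilon>\<^sub>1 \<upsilon>\<^sub>2 (parallel_arcs D k a) * (\<upsilon>\<^sub>2 a' * of_bool (a' \<in> inverse_arcs D k a))))"
    unfolding J_sum[OF a]
    by (intro arg_cong[where f = "(*) (\<upsilon>\<^sub>1 a)"] sum.cong refl) (simp add: inner)
  then show ?thesis
    by (simp add: arc_sum_def J_def flip: sum_distrib_right)
qed

text \<open>Every arc belongs to exactly one ordered pair: totality, or reflexivity for a loop,
  provides the pair, and antisymmetry excludes a second one. The representatives then split each
  pair into disjoint blocks.\<close>

lemma sum_arc_blocks:
  fixes g :: "'a \<Rightarrow> 'b::comm_monoid_add"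
  assumes "fin_digraph D" and "linear_order_on (verts D) R" and "block_representatives D k R B"
  shows "(\<Sum>a\<in>arcs D. g a) = (\<Sum>(u, v)\<in>arc_pairs D R. \<Sum>r\<in>B u v. \<Sum>a\<in>arc_block D k r. g a)"
    and "(u, v) \<in> arc_pairs D R \<Longrightarrow> B u v \<subseteq> arcs D"
proof -
  interpret fin_digraph D by fact
  have fin: "finite (arcs_from_to D u v)" "finite (arcs_between D u v)" for u v
    by (simp_all add: arcs_from_to_def arcs_between_def)
  have rep: "B u v \<subseteq> (if arcs_from_to D u v \<noteq> {} then arcs_from_to D u v else arcs_from_to D v u)"
      "arcs_between D u v = (\<Union>a\<in>B u v. arc_block D k a)"
      "disjoint_family_on (arc_block D k) (B u v)"
    if "(u, v) \<in> arc_pairs D R" for u v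
    using bspec[OF assms(3)[unfolded block_representatives_def] that] by blast+
  show Bsub: "B u v \<subseteq> arcs D" if "(u, v) \<in> arc_pairs D R" for u v
    using rep(1)[OF that] by (auto simp: arcs_from_to_def split: if_splits)
  have "antisym R" "total_on (verts D) R" "refl_on (verts D) R"
    using assms(2) by (auto simp: linear_order_on_def partial_order_on_def preorder_on_def)
  have union: "arcs D = (\<Union>(u, v)\<in>arc_pairs D R. arcs_between D u v)"
  proof (intro equalityI subsetI)
    fix a assume a: "a \<in> arcs D"
    then have verts: "tail D a \<in> verts D" "head D a \<in> verts D" by auto
    then have "(tail D a, head D a) \<in> R \<or> (head D a, tail D a) \<in> R"
      using \<open>total_on (verts D) R\<close> \<open>refl_on (verts D) R\<close>
      by (cases "tail D a = head D a") (auto simp: total_on_def refl_on_def)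
    then show "a \<in> (\<Union>(u, v)\<in>arc_pairs D R. arcs_between D u v)"
      using a verts by (force simp: arc_pairs_def arcs_between_def arcs_from_to_def)
  qed (auto simp: arcs_between_def arcs_from_to_def)
  have disj: "u = u' \<and> v = v'"
    if "(u, v) \<in> arc_pairs D R" "(u', v') \<in> arc_pairs D R"
      "a \<in> arcs_between D u v" "a \<in> arcs_between D u' v'" for a u v u' v'
    using that \<open>antisym R\<close>
    by (auto simp: arc_pairs_def arcs_between_def arcs_from_to_def antisym_def)
  have "finite (arc_pairs D R)"
    by (rule finite_subset[of _ "verts D \<times> verts D"]) (auto simp: arc_pairs_def)
  then have "(\<Sum>a\<in>arcs D. g a) = (\<Sum>(u, v)\<in>arc_pairs D R. \<Sum>a\<in>arcs_between D u v. g a)"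
    unfolding union using fin
    by (subst sum.UNION_disjoint) (auto simp: case_prod_unfold dest: disj)
  also have "\<dots> = (\<Sum>(u, v)\<in>arc_pairs D R. \<Sum>r\<in>B u v. \<Sum>a\<in>arc_block D k r. g a)"
  proof (intro sum.cong refl, clarify)
    fix u v assume uv: "(u, v) \<in> arc_pairs D R"
    have "finite (B u v)" using Bsub[OF uv] finite_subset finite_arcs by blast
    moreover have "finite (arc_block D k r)" if "r \<in> B u v" for r
      using arc_block_subset Bsub[OF uv] that finite_subset finite_arcs by blast
    ultimately show "(\<Sum>a\<in>arcs_between D u v. g a) = (\<Sum>r\<in>B u v. \<Sum>a\<in>arc_block D k r. g a)"
      unfolding rep(2)[OF uv] using rep(3)[OF uv]
      by (intro sum.UNION_disjoint) (auto simp: disjoint_family_on_def)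
  qed
  finally show "(\<Sum>a\<in>arcs D. g a)
      = (\<Sum>(u, v)\<in>arc_pairs D R. \<Sum>r\<in>B u v. \<Sum>a\<in>arc_block D k r. g a)" .
qed

end

section \<open>The inverse of I + xJ\<close>

lemma sum_of_bool_eq:
  fixes g :: "'a \<Rightarrow> 'b::comm_semiring_1"
  assumes "finite A" and "a \<in> A"
  shows "(\<Sum>b\<in>A. of_bool (a = b) * g b) = g a" and "(\<Sum>b\<in>A. g b * of_bool (b = a)) = g a"
  using assms by (subst sum.mono_neutral_right[of A "{a}"]; auto)+

text \<open>In the expanded product the terms with x^2 J^2 cancel, and J^3 = cJ leaves x J - d (1 -
  c x^2) x J = 0 next to the identity. The claim is made for one entry at a time because
  \<open>c\<close> and \<open>d\<close> may vary with the row.\<close>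

lemma cubic_left_inverse:
  fixes J :: "'a \<Rightarrow> 'a \<Rightarrow> 'b::comm_ring_1"
  assumes "finite A" and "a \<in> A" and "a' \<in> A"
    and cube: "(\<Sum>b\<in>A. J a b * (\<Sum>e\<in>A. J b e * J e a')) = c * J a a'"
    and inv: "d * (1 - c * x ^ 2) = 1"
  shows "(\<Sum>b\<in>A. (of_bool (a = b) - d * (x * J a b - x ^ 2 * (\<Sum>e\<in>A. J a e * J e b)))
      * (of_bool (b = a') + x * J b a')) = of_bool (a = a')"
proof -
  let ?J2 = "\<lambda>a b. \<Sum>e\<in>A. J a e * J e b"
  note delta = sum_of_bool_eq(1)[OF assms(1,2)] sum_of_bool_eq(2)[OF assms(1,3)]
  have cube': "(\<Sum>b\<in>A. ?J2 a b * J b a') = c * J a a'"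
  proof -
    have "(\<Sum>b\<in>A. ?J2 a b * J b a') = (\<Sum>b\<in>A. \<Sum>e\<in>A. J a e * (J e b * J b a'))"
      by (simp add: sum_distrib_right mult.assoc)
    also have "\<dots> = (\<Sum>e\<in>A. J a e * (\<Sum>b\<in>A. J e b * J b a'))"
      by (subst sum.swap) (simp add: sum_distrib_left)
    finally show ?thesis using cube by simp
  qed
  have "(\<Sum>b\<in>A. (of_bool (a = b) - d * (x * J a b - x ^ 2 * ?J2 a b)) * (of_bool (b = a') + x * J b a'))
      = (\<Sum>b\<in>A. of_bool (a = b) * (of_bool (b = a') + x * J b a')
          - d * x * (J a b * of_bool (b = a')) - d * x ^ 2 * (J a b * J b a')
          + d * x ^ 2 * (?J2 a b * of_bool (b = a')) + d * x ^ 3 * (?J2 a b * J b a'))"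
    by (intro sum.cong refl) (simp add: algebra_simps power2_eq_square power3_eq_cube)
  also have "\<dots> = of_bool (a = a') + x * J a a' - d * x * J a a' - d * x ^ 2 * ?J2 a a'
      + d * x ^ 2 * ?J2 a a' + d * x ^ 3 * (c * J a a')"
    by (simp only: sum.distrib sum_subtractf sum_distrib_left[symmetric] delta cube')
  also have "\<dots> = of_bool (a = a') + x * J a a' - d * (1 - c * x ^ 2) * (x * J a a')"
    by (simp add: algebra_simps power2_eq_square power3_eq_cube)
  finally show ?thesis unfolding inv by simp
qed

text \<open>The constant coefficient of the denominator is 1, so it is a unit of the power series
  ring.\<close>

lemma inverse_block_denom:
  "inverse (block_denom D k \<upsilon>\<^sub>1 \<upsilon>\<^sub>2 a) * block_denom D k \<upsilon>\<^sub>1 \<upsilon>\<^sub>2 a = 1"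
  by (rule inverse_mult_eq_1) (simp add: block_denom_def)

lemma set_restrict_to: "S \<subseteq> set as \<Longrightarrow> set (restrict_to as S) = S"
  by (auto simp: restrict_to_def)

lemma distinct_restrict_to: "distinct as \<Longrightarrow> distinct (restrict_to as S)"
  by (simp add: restrict_to_def)

section \<open>From the arc determinant to the vertex determinant\<close>

theorem theorem3p3:
  fixes D :: "('v, 'a) pre_digraph"
    and k :: "('v, 'e, 'a) digraph_kind"
    and R :: "'v rel"
    and B :: "'v \<Rightarrow> 'v \<Rightarrow> 'a set"
    and as :: "'a list"
    and vs :: "'v list"
    and \<tau>\<^sub>1 \<tau>\<^sub>2 \<upsilon>\<^sub>1 \<upsilon>\<^sub>2 :: "'a \<Rightarrow> complex"
    and \<theta> :: "'a \<Rightarrow> 'a \<Rightarrow> complex"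
  assumes "fin_digraph D"
    and "admissible_kind D k"
    and "linear_order_on (verts D) R"
    and "block_representatives D k R B"
    and "distinct as" and "set as = arcs D"
    and "distinct vs" and "set vs = verts D"
    and "\<theta> = (\<lambda>a a'. \<tau>\<^sub>1 a * \<tau>\<^sub>2 a' * of_bool (head D a = tail D a')
                    - \<upsilon>\<^sub>1 a * \<upsilon>\<^sub>2 a' * of_bool (a' \<in> inverse_arcs D k a))"
  shows "inverse (zeta D \<theta>) = det (1\<^sub>m (length as) - fps_X \<cdot>\<^sub>m fps_mat (indexed_mat as as \<theta>)) \<and>
    det (1\<^sub>m (length as) - fps_X \<cdot>\<^sub>m fps_mat (indexed_mat as as \<theta>)) =
      det (T_mat D k as \<upsilon>\<^sub>1 \<upsilon>\<^sub>2) *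
      det (1\<^sub>m (length vs) - fps_X \<cdot>\<^sub>m A_mat D k R B as vs \<tau>\<^sub>1 \<tau>\<^sub>2
        + fps_X ^ 2 \<cdot>\<^sub>m D_mat D k R B as vs \<tau>\<^sub>1 \<tau>\<^sub>2 \<upsilon>\<^sub>1 \<upsilon>\<^sub>2
        - fps_X ^ 3 \<cdot>\<^sub>m X_mat D k R B as vs \<tau>\<^sub>1 \<tau>\<^sub>2 \<upsilon>\<^sub>1 \<upsilon>\<^sub>2)"
proof
  interpret fin_digraph D by fact
  show "inverse (zeta D \<theta>) = det (1\<^sub>m (length as) - fps_X \<cdot>\<^sub>m fps_mat (indexed_mat as as \<theta>))"
  proof (rule zeta_eq_det[OF assms(5,6)])
    \<comment> \<open>The first summand of \<theta> contains the condition explicitly; the second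
      implies it, since an inverse arc of \<open>a\<close> starts at the head of
      \<open>a\<close>.\<close>
    fix a a' assume "a \<in> arcs D" "\<theta> a a' \<noteq> 0"
    then show "head D a = tail D a'"
      using inverse_arcs_subset[OF assms(2), of a]
      by (cases "head D a = tail D a'") (auto simp: assms(9) arcs_from_to_def)
  qed
  let ?n = "length as" and ?m = "length vs"
  define J where "J a a' = \<upsilon>\<^sub>1 a * \<upsilon>\<^sub>2 a' * of_bool (a' \<in> inverse_arcs D k a)" for a a'
  define K where "K a v = \<tau>\<^sub>1 a * of_bool (head D a = v)" for a v
  define L where "L u a = \<tau>\<^sub>2 a * of_bool (u = tail D a)" for u a
  define d where "d a = inverse (block_denom D k \<upsilon>\<^sub>1 \<upsilon>\<^sub>2 a)" for a
  define J\<^sub>2 where "J\<^sub>2 a a' = (\<Sum>e\<in>arcs D. fps_const (J a e) * fps_const (J e a'))" for a a'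
  \<comment> \<open>The row-wise candidate for the inverse of T, with \<open>J\<^sub>2\<close> the
    square of \<open>J\<close> over power series. The factor \<open>d a\<close> is attached to the
    arc of the row, and its constancy on blocks enters only when the sum is split.\<close>
  define T' where "T' = indexed_mat as as (\<lambda>a a'. of_bool (a = a')
      - d a * (fps_X * fps_const (J a a') - fps_X ^ 2 * J\<^sub>2 a a'))"
  let ?T = "T_mat D k as \<upsilon>\<^sub>1 \<upsilon>\<^sub>2"
  let ?K = "fps_mat (K_mat D as vs \<tau>\<^sub>1)" and ?L = "fps_mat (L_mat D as vs \<tau>\<^sub>2)"
  let ?M = "1\<^sub>m ?n - fps_X \<cdot>\<^sub>m fps_mat (indexed_mat as as \<theta>)"
  have J_mat: "J_mat D k xs \<upsilon>\<^sub>1 \<upsilon>\<^sub>2 = indexed_mat xs xs J" for xs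
    by (simp add: J_mat_def J_def[abs_def])
  have K_mat: "K_mat D xs vs \<tau>\<^sub>1 = indexed_mat xs vs K" for xs
    by (simp add: K_mat_def K_def[abs_def])
  have L_mat: "L_mat D xs vs \<tau>\<^sub>2 = indexed_mat vs xs L" for xs
    by (simp add: L_mat_def L_def[abs_def])
  have T: "?T = indexed_mat as as (\<lambda>a a'. of_bool (a = a') + fps_X * fps_const (J a a'))"
    by (simp add: T_mat_def J_mat indexed_mat_one[OF assms(5)] indexed_mat_arith)
  have carriers: "?T \<in> carrier_mat ?n ?n" "T' \<in> carrier_mat ?n ?n"
      "?K \<in> carrier_mat ?n ?m" "?L \<in> carrier_mat ?m ?n"
    by (simp_all add: T T'_def K_mat L_mat)
  have M_carrier: "?M \<in> carrier_mat ?n ?n"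
    by (intro minus_carrier_mat smult_carrier_mat) simp

  have T'T: "T' * ?T = 1\<^sub>m ?n"
    unfolding T'_def T indexed_mat_one[OF assms(5)] indexed_mat_mult[OF assms(5)]
  proof (rule indexed_mat_cong)
    fix a a' assume a: "a \<in> set as" "a' \<in> set as"
    let ?c = "fps_const (arc_sum \<upsilon>\<^sub>1 \<upsilon>\<^sub>2 (parallel_arcs D k a) * arc_sum \<upsilon>\<^sub>1 \<upsilon>\<^sub>2 (inverse_arcs D k a))"
    have "(\<Sum>b\<in>arcs D. J a b * (\<Sum>e\<in>arcs D. J b e * J e a'))
        = arc_sum \<upsilon>\<^sub>1 \<upsilon>\<^sub>2 (parallel_arcs D k a) * arc_sum \<upsilon>\<^sub>1 \<upsilon>\<^sub>2 (inverse_arcs D k a) * J a a'"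
      using J_cubed[OF assms(2) finite_arcs] a assms(6) unfolding J_def by simp
    from arg_cong[OF this, of fps_const]
    have "(\<Sum>b\<in>set as. fps_const (J a b) * (\<Sum>e\<in>set as. fps_const (J b e) * fps_const (J e a')))
        = ?c * fps_const (J a a')"
      by (simp only: assms(6) fps_const_sum fps_const_mult[symmetric])
    moreover have "d a * (1 - ?c * fps_X ^ 2) = 1"
      using inverse_block_denom[of D k \<upsilon>\<^sub>1 \<upsilon>\<^sub>2 a] by (simp add: d_def block_denom_def)
    ultimately show "(\<Sum>b\<in>set as. (of_bool (a = b)
          - d a * (fps_X * fps_const (J a b) - fps_X ^ 2 * J\<^sub>2 a b))
        * (of_bool (b = a') + fps_X * fps_const (J b a'))) = of_bool (a = a')"
      unfolding J\<^sub>2_def assms(6)[symmetric] using a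
      by (intro cubic_left_inverse) auto
  qed

  have M: "?M = ?T - fps_X \<cdot>\<^sub>m (?K * ?L)"
    unfolding T K_mat L_mat indexed_mat_one[OF assms(5)] indexed_mat_arith
      indexed_mat_mult[OF assms(7)]
  proof (rule indexed_mat_cong)
    fix a a' assume a: "a \<in> set as" "a' \<in> set as"
    \<comment> \<open>Only the head of \<open>a\<close> contributes, and it is listed in
      \<open>vs\<close> because the arcs of the digraph end in its vertices.\<close>
    have "(\<Sum>v\<in>set vs. K a v * L v a') = (\<Sum>v\<in>{head D a}. K a v * L v a')"
      using a assms(6,8) by (intro sum.mono_neutral_right) (auto simp: K_def)
    then have "\<theta> a a' = (\<Sum>v\<in>set vs. K a v * L v a') - J a a'"
      by (simp add: assms(9) J_def K_def L_def)
    then have \<theta>: "fps_const (\<theta> a a')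
        = (\<Sum>v\<in>set vs. fps_const (K a v) * fps_const (L v a')) - fps_const (J a a')"
      by (simp add: fps_const_sum flip: fps_const_sub)
    show "of_bool (a = a') - fps_X * fps_const (\<theta> a a')
        = of_bool (a = a') + fps_X * fps_const (J a a')
          - fps_X * (\<Sum>v\<in>set vs. fps_const (K a v) * fps_const (L v a'))"
      unfolding \<theta> by (simp only: algebra_simps)
  qed

  \<comment> \<open>Multiplying by T' on the left turns T - tKL into I - tT'KL, the shape required
    by Sylvester's identity; a left inverse suffices here.\<close>
  have "det T' * det ?M = det (T' * ?M)"
    using carriers(2) M_carrier by (simp only: det_mult)
  also have "T' * ?M = 1\<^sub>m ?n - fps_X \<cdot>\<^sub>m (T' * ?K) * ?L"
    unfolding M using carriers
    by (simp add: mult_minus_distrib_mat[of _ ?n ?n _ ?n] T'T mult_smult_distrib[of _ ?n ?n _ ?n]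
        mult_smult_assoc_mat[of _ ?n ?m _ ?n] assoc_mult_mat[of _ ?n ?n _ ?m _ ?n])
  also have "det \<dots> = det (1\<^sub>m ?m - ?L * (fps_X \<cdot>\<^sub>m (T' * ?K)))"
    using carriers by (intro det_one_minus_mult_commute) auto
  also have "1\<^sub>m ?m - ?L * (fps_X \<cdot>\<^sub>m (T' * ?K)) =
      1\<^sub>m ?m - fps_X \<cdot>\<^sub>m A_mat D k R B as vs \<tau>\<^sub>1 \<tau>\<^sub>2
        + fps_X ^ 2 \<cdot>\<^sub>m D_mat D k R B as vs \<tau>\<^sub>1 \<tau>\<^sub>2 \<upsilon>\<^sub>1 \<upsilon>\<^sub>2
        - fps_X ^ 3 \<cdot>\<^sub>m X_mat D k R B as vs \<tau>\<^sub>1 \<tau>\<^sub>2 \<upsilon>\<^sub>1 \<upsilon>\<^sub>2"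
  proof -
    let ?JK = "\<lambda>S a v. \<Sum>b\<in>S. J a b * K b v"
    let ?JJK = "\<lambda>S a v. \<Sum>b\<in>S. J a b * ?JK S b v"
    let ?blk = "arc_block D k"
    \<comment> \<open>An entry of T'K, with the contributions of JK and J^2 K collected as complex
      numbers.\<close>
    have T'K: "(\<Sum>b\<in>arcs D. (of_bool (a = b)
          - d a * (fps_X * fps_const (J a b) - fps_X ^ 2 * J\<^sub>2 a b)) * fps_const (K b v))
        = fps_const (K a v) - d a * (fps_X * fps_const (?JK (arcs D) a v)
            - fps_X ^ 2 * fps_const (?JJK (arcs D) a v))" (is "?l = _")
      if "a \<in> arcs D" for a v
    proof -
      have delta: "(\<Sum>b\<in>arcs D. of_bool (a = b) * fps_const (K b v)) = fps_const (K a v)"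
        using that by (simp add: sum_of_bool_eq)
      have "(\<Sum>b\<in>arcs D. J\<^sub>2 a b * fps_const (K b v))
          = (\<Sum>b\<in>arcs D. \<Sum>e\<in>arcs D. fps_const (J a e) * (fps_const (J e b) * fps_const (K b v)))"
        unfolding J\<^sub>2_def by (simp add: sum_distrib_right mult.assoc)
      also have "\<dots> = fps_const (?JJK (arcs D) a v)"
        by (subst sum.swap) (simp add: fps_const_sum sum_distrib_left)
      finally have J\<^sub>2K: "(\<Sum>b\<in>arcs D. J\<^sub>2 a b * fps_const (K b v)) = \<dots>" .
      have "?l = (\<Sum>b\<in>arcs D. of_bool (a = b) * fps_const (K b v)
          - d a * fps_X * (fps_const (J a b) * fps_const (K b v))
          + d a * fps_X ^ 2 * (J\<^sub>2 a b * fps_const (K b v)))"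
        by (intro sum.cong refl) (simp only: algebra_simps)
      also have "\<dots> = fps_const (K a v) - d a * fps_X * fps_const (?JK (arcs D) a v)
          + d a * fps_X ^ 2 * fps_const (?JJK (arcs D) a v)"
        by (simp only: sum.distrib sum_subtractf sum_distrib_left[symmetric] delta J\<^sub>2K
            fps_const_sum fps_const_mult)
      finally show ?thesis by (simp add: algebra_simps)
    qed
    \<comment> \<open>Starting inside a block, all nonzero terms stay in it by block diagonality,
      also after a second application of \<open>J\<close>.\<close>
    have restrict: "?JK (arcs D) a v = ?JK (?blk r) a v" "?JJK (arcs D) a v = ?JJK (?blk r) a v"
      if r: "r \<in> arcs D" and a: "a \<in> ?blk r" for r a v
    proof -
      have sub: "?blk r \<subseteq> arcs D" using arc_block_subset[OF assms(2) r] .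
      have *: "(\<Sum>b\<in>arcs D. J c b * g b) = (\<Sum>b\<in>?blk r. J c b * g b)" if "c \<in> ?blk r" for c g
        using sub inverse_arcs_subset_block[OF assms(2) r that]
        by (intro sum.mono_neutral_right) (auto simp: J_def)
      show "?JK (arcs D) a v = ?JK (?blk r) a v" by (rule *[OF a])
      have "?JJK (arcs D) a v = (\<Sum>b\<in>?blk r. J a b * ?JK (arcs D) b v)" by (rule *[OF a])
      also have "\<dots> = ?JJK (?blk r) a v" by (intro sum.cong refl) (simp add: *)
      finally show "?JJK (arcs D) a v = ?JJK (?blk r) a v" .
    qed
    have entries:
      "fps_mat (L_mat D (restrict_to as (?blk r)) vs \<tau>\<^sub>2 * K_mat D (restrict_to as (?blk r)) vs \<tau>\<^sub>1)
        = indexed_mat vs vs (\<lambda>u v. fps_const (\<Sum>a\<in>?blk r. L u a * K a v))"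
      "fps_mat (L_mat D (restrict_to as (?blk r)) vs \<tau>\<^sub>2 * J_mat D k (restrict_to as (?blk r)) \<upsilon>\<^sub>1 \<upsilon>\<^sub>2
          * K_mat D (restrict_to as (?blk r)) vs \<tau>\<^sub>1)
        = indexed_mat vs vs (\<lambda>u v. fps_const (\<Sum>a\<in>?blk r. L u a * ?JK (?blk r) a v))"
      "fps_mat (L_mat D (restrict_to as (?blk r)) vs \<tau>\<^sub>2
          * (J_mat D k (restrict_to as (?blk r)) \<upsilon>\<^sub>1 \<upsilon>\<^sub>2 ^\<^sub>m 2)
          * K_mat D (restrict_to as (?blk r)) vs \<tau>\<^sub>1)
        = indexed_mat vs vs (\<lambda>u v. fps_const (\<Sum>a\<in>?blk r. L u a * ?JJK (?blk r) a v))"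
      if r: "r \<in> arcs D" for r
    proof -
      let ?S = "restrict_to as (?blk r)"
      have S: "set ?S = ?blk r"
        using arc_block_subset[OF assms(2) r] assms(6) by (simp add: set_restrict_to)
      note mult = indexed_mat_mult[OF distinct_restrict_to[OF assms(5)], of _ "?blk r", unfolded S]
      \<comment> \<open>Bracketing to the right makes the products unfold into the nested sums
        \<open>?JK\<close> and, below, \<open>?JJK\<close>.\<close>
      have LJK: "indexed_mat vs ?S L * indexed_mat ?S ?S J * indexed_mat ?S vs K
          = indexed_mat vs vs (\<lambda>u v. \<Sum>a\<in>?blk r. L u a * ?JK (?blk r) a v)"
      proof -
        have "indexed_mat vs ?S L * indexed_mat ?S ?S J * indexed_mat ?S vs K
            = indexed_mat vs ?S L * (indexed_mat ?S ?S J * indexed_mat ?S vs K)"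
          by (rule assoc_mult_mat[OF indexed_mat_carrier indexed_mat_carrier indexed_mat_carrier])
        also have "\<dots> = indexed_mat vs vs (\<lambda>u v. \<Sum>a\<in>?blk r. L u a * ?JK (?blk r) a v)"
          unfolding mult ..
        finally show ?thesis .
      qed
      have LJJK: "indexed_mat vs ?S L * (indexed_mat ?S ?S J ^\<^sub>m 2) * indexed_mat ?S vs K
          = indexed_mat vs vs (\<lambda>u v. \<Sum>a\<in>?blk r. L u a * ?JJK (?blk r) a v)"
      proof -
        have JJ: "indexed_mat ?S ?S J * indexed_mat ?S ?S J \<in> carrier_mat (length ?S) (length ?S)"
          by (rule mult_carrier_mat[OF indexed_mat_carrier indexed_mat_carrier])
        have "indexed_mat vs ?S L * (indexed_mat ?S ?S J ^\<^sub>m 2) * indexed_mat ?S vs K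
            = indexed_mat vs ?S L * (indexed_mat ?S ?S J * (indexed_mat ?S ?S J * indexed_mat ?S vs K))"
          by (simp add: numeral_2_eq_2 assoc_mult_mat[OF indexed_mat_carrier JJ indexed_mat_carrier]
              assoc_mult_mat[OF indexed_mat_carrier indexed_mat_carrier indexed_mat_carrier])
        also have "\<dots> = indexed_mat vs vs (\<lambda>u v. \<Sum>a\<in>?blk r. L u a * ?JJK (?blk r) a v)"
          unfolding mult ..
        finally show ?thesis .
      qed
      show "fps_mat (L_mat D ?S vs \<tau>\<^sub>2 * K_mat D ?S vs \<tau>\<^sub>1)
          = indexed_mat vs vs (\<lambda>u v. fps_const (\<Sum>a\<in>?blk r. L u a * K a v))"
        unfolding L_mat K_mat mult indexed_mat_arith ..
      show "fps_mat (L_mat D ?S vs \<tau>\<^sub>2 * J_mat D k ?S \<upsilon>\<^sub>1 \<upsilon>\<^sub>2 * K_mat D ?S vs \<tau>\<^sub>1)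
          = indexed_mat vs vs (\<lambda>u v. fps_const (\<Sum>a\<in>?blk r. L u a * ?JK (?blk r) a v))"
        unfolding L_mat K_mat J_mat LJK indexed_mat_arith ..
      show "fps_mat (L_mat D ?S vs \<tau>\<^sub>2 * (J_mat D k ?S \<upsilon>\<^sub>1 \<upsilon>\<^sub>2 ^\<^sub>m 2) * K_mat D ?S vs \<tau>\<^sub>1)
          = indexed_mat vs vs (\<lambda>u v. fps_const (\<Sum>a\<in>?blk r. L u a * ?JJK (?blk r) a v))"
        unfolding L_mat K_mat J_mat LJJK indexed_mat_arith ..
    qed
    \<comment> \<open>On the block of \<open>r\<close> every \<open>d a\<close> equals
      \<open>d r\<close>, so the denominator can be taken out of the sum.\<close>
    have block: "(\<Sum>a\<in>?blk r. fps_const (L u a) * (fps_const (K a v)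
          - d a * (fps_X * fps_const (?JK (arcs D) a v) - fps_X ^ 2 * fps_const (?JJK (arcs D) a v))))
        = fps_const (\<Sum>a\<in>?blk r. L u a * K a v)
          - fps_X * (d r * fps_const (\<Sum>a\<in>?blk r. L u a * ?JK (?blk r) a v))
          + fps_X ^ 2 * (d r * fps_const (\<Sum>a\<in>?blk r. L u a * ?JJK (?blk r) a v))"
      (is "?l = _") if r: "r \<in> arcs D" for r u v
    proof -
      have "?l = (\<Sum>a\<in>?blk r. fps_const (L u a * K a v)
          - fps_X * d r * fps_const (L u a * ?JK (?blk r) a v)
          + fps_X ^ 2 * d r * fps_const (L u a * ?JJK (?blk r) a v))"
      proof (intro sum.cong refl)
        fix a assume a: "a \<in> ?blk r"
        have "d a = d r" unfolding d_def block_denom_block[OF assms(2) r a] ..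
        then show "fps_const (L u a) * (fps_const (K a v)
            - d a * (fps_X * fps_const (?JK (arcs D) a v) - fps_X ^ 2 * fps_const (?JJK (arcs D) a v)))
          = fps_const (L u a * K a v) - fps_X * d r * fps_const (L u a * ?JK (?blk r) a v)
            + fps_X ^ 2 * d r * fps_const (L u a * ?JJK (?blk r) a v)"
          unfolding restrict[OF r a] fps_const_mult[symmetric] by (simp only: algebra_simps)
      qed
      then show ?thesis
        by (simp only: sum.distrib sum_subtractf sum_distrib_left[symmetric] fps_const_sum mult.assoc)
    qed
    let ?sum = "\<lambda>F. \<Sum>(u, v)\<in>arc_pairs D R. \<Sum>r\<in>B u v. F r"
    \<comment> \<open>Representatives are arcs, so facts about arcs may be applied under the double
      sum.\<close>
    have sum_cong: "?sum F = ?sum G" if "\<And>r. r \<in> arcs D \<Longrightarrow> F r = G r" for F G :: "'a \<Rightarrow> complex fps"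
      using sum_arc_blocks(2)[OF assms(2,1,3,4)] that
      by (intro sum.cong refl) (auto intro!: sum.cong)
    have sum_lin: "?sum (\<lambda>r. F r - c * G r + e * H r) = ?sum F - c * ?sum G + e * ?sum H"
      for F G H :: "'a \<Rightarrow> complex fps" and c e
      by (simp add: case_prod_unfold sum.distrib sum_subtractf sum_distrib_left)
    have A: "A_mat D k R B as vs \<tau>\<^sub>1 \<tau>\<^sub>2
        = indexed_mat vs vs (\<lambda>u v. ?sum (\<lambda>r. fps_const (\<Sum>a\<in>?blk r. L u a * K a v)))"
      unfolding A_mat_def block_sum_def Let_def
      by (intro eq_matI) (auto intro!: sum_cong simp: entries)
    have D: "D_mat D k R B as vs \<tau>\<^sub>1 \<tau>\<^sub>2 \<upsilon>\<^sub>1 \<upsilon>\<^sub>2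
        = indexed_mat vs vs (\<lambda>u v. ?sum (\<lambda>r. d r * fps_const (\<Sum>a\<in>?blk r. L u a * ?JK (?blk r) a v)))"
      unfolding D_mat_def block_sum_def Let_def
      by (intro eq_matI) (auto intro!: sum_cong simp: entries d_def)
    have X: "X_mat D k R B as vs \<tau>\<^sub>1 \<tau>\<^sub>2 \<upsilon>\<^sub>1 \<upsilon>\<^sub>2
        = indexed_mat vs vs (\<lambda>u v. ?sum (\<lambda>r. d r * fps_const (\<Sum>a\<in>?blk r. L u a * ?JJK (?blk r) a v)))"
      unfolding X_mat_def block_sum_def Let_def
      by (intro eq_matI) (auto intro!: sum_cong simp: entries d_def)
    show ?thesis
      unfolding A D X T'_def K_mat L_mat indexed_mat_one[OF assms(7)] indexed_mat_arith
        indexed_mat_mult[OF assms(5)] assms(6)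
    proof (rule indexed_mat_cong)
      fix u v
      \<comment> \<open>\<open>?h a\<close> is the contribution of the arc \<open>a\<close> to the
        (u, v) entry of LT'K.\<close>
      let ?h = "\<lambda>a. fps_const (L u a) * (fps_const (K a v)
          - d a * (fps_X * fps_const (?JK (arcs D) a v) - fps_X ^ 2 * fps_const (?JJK (arcs D) a v)))"
      have "(\<Sum>a\<in>arcs D. fps_const (L u a) * (fps_X * (\<Sum>b\<in>arcs D. (of_bool (a = b)
          - d a * (fps_X * fps_const (J a b) - fps_X ^ 2 * J\<^sub>2 a b)) * fps_const (K b v))))
          = (\<Sum>a\<in>arcs D. fps_X * ?h a)"
        by (intro sum.cong refl) (simp only: T'K mult.left_commute)
      also have "\<dots> = fps_X * (\<Sum>a\<in>arcs D. ?h a)"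
        by (rule sum_distrib_left[symmetric])
      also have "(\<Sum>a\<in>arcs D. ?h a) = ?sum (\<lambda>r. \<Sum>a\<in>?blk r. ?h a)"
        by (rule sum_arc_blocks(1)[OF assms(2,1,3,4)])
      also have "\<dots> = ?sum (\<lambda>r. fps_const (\<Sum>a\<in>?blk r. L u a * K a v)
          - fps_X * (d r * fps_const (\<Sum>a\<in>?blk r. L u a * ?JK (?blk r) a v))
          + fps_X ^ 2 * (d r * fps_const (\<Sum>a\<in>?blk r. L u a * ?JJK (?blk r) a v)))"
        by (rule sum_cong) (rule block)
      \<comment> \<open>The factor \<open>fps_X\<close> taken out above raises the exponents 0, 1, 2
        of the three sums to 1, 2, 3, and the subtraction from the identity gives the alternating
        signs.\<close>
      finally show "of_bool (u = v)
          - (\<Sum>a\<in>arcs D. fps_const (L u a) * (fps_X * (\<Sum>b\<in>arcs D. (of_bool (a = b)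
              - d a * (fps_X * fps_const (J a b) - fps_X ^ 2 * J\<^sub>2 a b)) * fps_const (K b v))))
        = of_bool (u = v)
          - fps_X * ?sum (\<lambda>r. fps_const (\<Sum>a\<in>?blk r. L u a * K a v))
          + fps_X ^ 2 * ?sum (\<lambda>r. d r * fps_const (\<Sum>a\<in>?blk r. L u a * ?JK (?blk r) a v))
          - fps_X ^ 3 * ?sum (\<lambda>r. d r * fps_const (\<Sum>a\<in>?blk r. L u a * ?JJK (?blk r) a v))"
        unfolding sum_lin by (simp only:) (simp add: algebra_simps power2_eq_square power3_eq_cube)
    qed
  qed
  finally have main: "det T' * det ?M = det (1\<^sub>m ?m - fps_X \<cdot>\<^sub>m A_mat D k R B as vs \<tau>\<^sub>1 \<tau>\<^sub>2
        + fps_X ^ 2 \<cdot>\<^sub>m D_mat D k R B as vs \<tau>\<^sub>1 \<tau>\<^sub>2 \<upsilon>\<^sub>1 \<upsilon>\<^sub>2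
        - fps_X ^ 3 \<cdot>\<^sub>m X_mat D k R B as vs \<tau>\<^sub>1 \<tau>\<^sub>2 \<upsilon>\<^sub>1 \<upsilon>\<^sub>2)" .
  \<comment> \<open>Since det T is a unit with inverse det T', it can be moved to the other
    side.\<close>
  have "det T' * det ?T = 1"
    using carriers T'T det_mult[of T' ?n ?T] by simp
  then have "det ?T * (det T' * det ?M) = det ?M"
    by (simp add: mult.commute mult.left_commute)
  then show "det ?M = det ?T * det (1\<^sub>m ?m - fps_X \<cdot>\<^sub>m A_mat D k R B as vs \<tau>\<^sub>1 \<tau>\<^sub>2
        + fps_X ^ 2 \<cdot>\<^sub>m D_mat D k R B as vs \<tau>\<^sub>1 \<tau>\<^sub>2 \<upsilon>\<^sub>1 \<upsilon>\<^sub>2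
        - fps_X ^ 3 \<cdot>\<^sub>m X_mat D k R B as vs \<tau>\<^sub>1 \<tau>\<^sub>2 \<upsilon>\<^sub>1 \<upsilon>\<^sub>2)"
    unfolding main by simp
qed

end
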